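(* Let $(X,\tau)$ be a topological space that is strongly irresolvable (or submaximal). Then $(X,\tau)$ is p-closed if and only if it is quasi-H-closed.
   Context: No separation axioms are assumed. A subset $A$ of a space $(X,\tau)$ is preopen if $A \subseteq \mathrm{int}(\mathrm{cl}(A))$; it is preclosed if its complement is preopen. The preclosure $\mathrm{pcl}(A)$ is the intersection of all preclosed supersets of $A$. $(X,\tau)$ is p-closed if for every cover $\{V_\alpha : \alpha\in A\}$ of $X$ by preopen sets there is a finite $A_0\subseteq A$ with $X=\bigcup_{\alpha\in A_0}\mathrm{pcl}(V_\alpha)$. $(X,\tau)$ is quasi-H-closed (QHC) if for every open cover $\{V_\alpha : \alpha\in A\}$ of $X$ there is a finite $A_0\subseteq A$ with $X=\bigcup_{\alpha\in A_0}\mathrm{cl}(V_\alpha)$. A space is resolvable if it is the disjoint union of two dense subsets, and irresolvable otherwise; $(X,\tau)$ is strongly irresolvable if every nonempty open subspace of $X$ is irresolvable. $(X,\tau)$ is submaximal if every dense subset of $X$ is open. *)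

theory Defs
  imports "HOL-Analysis.Analysis"
begin

text \<open>
  Spaces are abstract topologies, without separation axioms; the empty space is allowed.
  A family of subsets is represented by the set of its members. This loses nothing here:
  the covering properties below depend only on which sets occur in the family.
\<close>

definition preopenin :: "'a topology \<Rightarrow> 'a set \<Rightarrow> bool" where
  "preopenin X A \<longleftrightarrow> A \<subseteq> topspace X \<and> A \<subseteq> X interior_of (X closure_of A)"

definition preclosedin :: "'a topology \<Rightarrow> 'a set \<Rightarrow> bool" where
  "preclosedin X A \<longleftrightarrow> A \<subseteq> topspace X \<and> preopenin X (topspace X - A)"

text \<open>
  For \<open>A \<subseteq> topspace X\<close> the intersection is over a nonempty collection, since the whole space
  is preclosed.
\<close>

definition preclosure_of :: "'a topology \<Rightarrow> 'a set \<Rightarrow> 'a set" (infixr "preclosure'_of" 80) where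
  "X preclosure_of A = \<Inter> {C. preclosedin X C \<and> A \<subseteq> C}"

definition p_closed_space :: "'a topology \<Rightarrow> bool" where
  "p_closed_space X \<longleftrightarrow>
    (\<forall>\<V>. (\<forall>V\<in>\<V>. preopenin X V) \<and> \<Union>\<V> = topspace X \<longrightarrow>
      (\<exists>\<F>. finite \<F> \<and> \<F> \<subseteq> \<V> \<and> topspace X = (\<Union>V\<in>\<F>. X preclosure_of V)))"

definition quasi_H_closed_space :: "'a topology \<Rightarrow> bool" where
  "quasi_H_closed_space X \<longleftrightarrow>
    (\<forall>\<V>. (\<forall>V\<in>\<V>. openin X V) \<and> \<Union>\<V> = topspace X \<longrightarrow>
      (\<exists>\<F>. finite \<F> \<and> \<F> \<subseteq> \<V> \<and> topspace X = (\<Union>V\<in>\<F>. X closure_of V)))"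

definition dense_subset :: "'a topology \<Rightarrow> 'a set \<Rightarrow> bool" where
  "dense_subset X D \<longleftrightarrow> D \<subseteq> topspace X \<and> X closure_of D = topspace X"

definition resolvable_space :: "'a topology \<Rightarrow> bool" where
  "resolvable_space X \<longleftrightarrow>
    (\<exists>D E. dense_subset X D \<and> dense_subset X E \<and> D \<inter> E = {} \<and> D \<union> E = topspace X)"

abbreviation irresolvable_space :: "'a topology \<Rightarrow> bool" where
  "irresolvable_space X \<equiv> \<not> resolvable_space X"

definition strongly_irresolvable_space :: "'a topology \<Rightarrow> bool" where
  "strongly_irresolvable_space X \<longleftrightarrow>
    (\<forall>U. openin X U \<and> U \<noteq> {} \<longrightarrow> irresolvable_space (subtopology X U))"

definition submaximal_space :: "'a topology \<Rightarrow> bool" where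
  "submaximal_space X \<longleftrightarrow> (\<forall>D. dense_subset X D \<longrightarrow> openin X D)"

end

theory Submission
  imports Defs
begin

text \<open>
  Preopen sets and their preclosures are compared with open sets and their closures.
  One direction holds in every space: open sets are preopen and closed sets are preclosed, so an
  open cover is a preopen cover whose members satisfy \<open>X preclosure_of V \<subseteq> X closure_of V\<close>.

  For the other direction, a preopen cover \<open>\<V>\<close> is replaced by the open cover consisting of the sets
  \<open>X interior_of (X closure_of V)\<close>, whose closures lie in \<open>X closure_of V\<close>. What remains is to
  bound \<open>X closure_of V\<close> by \<open>X preclosure_of V\<close>. In any space
  \<open>X closure_of (X interior_of V) \<subseteq> X preclosure_of V\<close>, so it is enough that \<open>V\<close> lies in the
  closure of its own interior. This is where irresolvability enters
  (\<open>preopen_subset_closure_of_interior\<close>): a preopen set is dense in the open set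
  \<open>X interior_of (X closure_of V)\<close>, and away from the closure of its interior its complement is
  dense too, so a point of \<open>V\<close> outside that closure would have a resolvable open neighbourhood.

  Submaximality is covered because it implies strong irresolvability: one half of a resolution
  of a nonempty open subspace would have to be open, so the other half, being dense, would meet it.
\<close>

lemma open_imp_preopen:
  assumes "openin X U"
  shows "preopenin X U"
  unfolding preopenin_def
  using assms by (meson closure_of_subset interior_of_maximal openin_subset)

lemma closed_imp_preclosed:
  assumes "closedin X C"
  shows "preclosedin X C"
  unfolding preclosedin_def
  using assms by (simp add: closedin_def open_imp_preopen)

lemma preclosure_of_subset_closure_of:
  assumes "A \<subseteq> topspace X"
  shows "X preclosure_of A \<subseteq> X closure_of A"
  unfolding preclosure_of_def
  by (intro Inter_lower CollectI conjI closed_imp_preclosed closedin_closure_of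
      closure_of_subset[OF assms])

lemma preclosure_of_subset_topspace:
  assumes "A \<subseteq> topspace X"
  shows "X preclosure_of A \<subseteq> topspace X"
  using preclosure_of_subset_closure_of[OF assms] closure_of_subset_topspace
  by (rule subset_trans)

text \<open>The dual, under complementation, of the inclusion that defines preopen sets.\<close>

lemma preclosed_closure_of_interior_subset:
  assumes "preclosedin X C"
  shows "X closure_of (X interior_of C) \<subseteq> C"
proof -
  have "topspace X - C \<subseteq> X interior_of (X closure_of (topspace X - C))"
    using assms by (simp add: preclosedin_def preopenin_def)
  also have "\<dots> = topspace X - X closure_of (X interior_of C)"
    by (simp add: closure_of_complement interior_of_complement)
  finally show ?thesis
    using closure_of_subset_topspace[of X "X interior_of C"] by blast
qed

lemma closure_of_interior_subset_preclosure_of: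
  "X closure_of (X interior_of A) \<subseteq> X preclosure_of A"
  unfolding preclosure_of_def
proof (intro Inter_greatest, elim CollectE conjE)
  fix C assume "preclosedin X C" "A \<subseteq> C"
  then show "X closure_of (X interior_of A) \<subseteq> C"
    by (meson closure_of_mono interior_of_mono preclosed_closure_of_interior_subset subset_trans)
qed

lemma dense_subset_subtopology_iff:
  assumes "openin X U"
  shows "dense_subset (subtopology X U) D \<longleftrightarrow>
    D \<subseteq> U \<and> (\<forall>W. openin X W \<and> W \<subseteq> U \<and> W \<noteq> {} \<longrightarrow> D \<inter> W \<noteq> {})"
proof -
  have top: "topspace (subtopology X U) = U"
    using openin_subset[OF assms] by (rule topspace_subtopology_subset)
  show ?thesis
    using dense_intersects_open[of "subtopology X U" D]
    unfolding dense_subset_def top openin_open_subtopology[OF assms]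
    by (simp only: conj_assoc)
qed

text \<open>
  Adjoining the complement of an open set \<open>U\<close> makes a dense subset of \<open>U\<close> dense in the whole
  space; submaximality then makes that subset the intersection of two open sets.
\<close>

lemma submaximal_imp_strongly_irresolvable:
  assumes "submaximal_space X"
  shows "strongly_irresolvable_space X"
  unfolding strongly_irresolvable_space_def
proof (intro allI impI notI, elim conjE)
  fix U
  assume U: "openin X U" "U \<noteq> {}" and res: "resolvable_space (subtopology X U)"
  obtain D E where D: "dense_subset (subtopology X U) D" and E: "dense_subset (subtopology X U) E"
    and disj: "D \<inter> E = {}"
    using res unfolding resolvable_space_def by blast
  have DU: "D \<subseteq> U" and Dmeets: "\<And>W. openin X W \<Longrightarrow> W \<subseteq> U \<Longrightarrow> W \<noteq> {} \<Longrightarrow> D \<inter> W \<noteq> {}"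
    using D unfolding dense_subset_subtopology_iff[OF U(1)] by auto
  have Emeets: "\<And>W. openin X W \<Longrightarrow> W \<subseteq> U \<Longrightarrow> W \<noteq> {} \<Longrightarrow> E \<inter> W \<noteq> {}"
    using E unfolding dense_subset_subtopology_iff[OF U(1)] by auto
  have "dense_subset X (D \<union> (topspace X - U))"
    unfolding dense_subset_def dense_intersects_open
  proof (intro conjI allI impI)
    show "D \<union> (topspace X - U) \<subseteq> topspace X"
      using DU openin_subset[OF U(1)] by blast
  next
    fix W assume "openin X W \<and> W \<noteq> {}"
    then have W: "openin X W" "W \<noteq> {}"
      by auto
    show "(D \<union> (topspace X - U)) \<inter> W \<noteq> {}"
    proof (cases "W \<subseteq> U")
      case True
      then show ?thesis using Dmeets W by blast
    next
      case False
      then show ?thesis using openin_subset[OF W(1)] by blast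
    qed
  qed
  then have "openin X (D \<union> (topspace X - U))"
    using assms submaximal_space_def by blast
  then have "openin X ((D \<union> (topspace X - U)) \<inter> U)"
    using U(1) by blast
  moreover have "(D \<union> (topspace X - U)) \<inter> U = D"
    using DU by blast
  ultimately have "openin X D"
    by simp
  moreover have "D \<noteq> {}"
    using Dmeets[OF U(1)] U(2) by blast
  ultimately show False
    using Emeets DU disj by blast
qed

text \<open>
  Otherwise \<open>A\<close> and its complement would both be dense in the nonempty open set obtained from
  \<open>X interior_of (X closure_of A)\<close> by removing \<open>X closure_of (X interior_of A)\<close>: the former because
  that set lies in the closure of \<open>A\<close>, the latter because it contains no interior point of \<open>A\<close>.
\<close>

lemma preopen_subset_closure_of_interior:
  assumes "strongly_irresolvable_space X" and A: "preopenin X A"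
  shows "A \<subseteq> X closure_of (X interior_of A)"
proof (rule ccontr)
  define U where "U = X interior_of (X closure_of A) - X closure_of (X interior_of A)"
  assume "\<not> A \<subseteq> X closure_of (X interior_of A)"
  then have "U \<noteq> {}"
    using A unfolding preopenin_def U_def by blast
  have "openin X U"
    unfolding U_def by (intro openin_diff openin_interior_of closedin_closure_of)
  have no_int: "U \<inter> X interior_of A = {}"
    using closure_of_subset[OF interior_of_subset_topspace[of X A]] unfolding U_def by blast
  have "dense_subset (subtopology X U) (A \<inter> U)"
    unfolding dense_subset_subtopology_iff[OF \<open>openin X U\<close>]
  proof (intro conjI allI impI)
    fix W assume "openin X W \<and> W \<subseteq> U \<and> W \<noteq> {}"
    then have W: "openin X W" "W \<subseteq> U" "W \<noteq> {}"
      by auto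
    have "W \<subseteq> X closure_of A"
      using W(2) interior_of_subset[of X "X closure_of A"] unfolding U_def by blast
    then have "A \<inter> W \<noteq> {}"
      using W openin_Int_closure_of_eq_empty[OF W(1), of A] by blast
    then show "A \<inter> U \<inter> W \<noteq> {}"
      using W(2) by blast
  qed blast
  moreover have "dense_subset (subtopology X U) (U - A)"
    unfolding dense_subset_subtopology_iff[OF \<open>openin X U\<close>]
  proof (intro conjI allI impI)
    fix W assume "openin X W \<and> W \<subseteq> U \<and> W \<noteq> {}"
    then have W: "openin X W" "W \<subseteq> U" "W \<noteq> {}"
      by auto
    have "\<not> W \<subseteq> A"
      using W no_int interior_of_maximal[OF _ W(1), of A] by blast
    then show "(U - A) \<inter> W \<noteq> {}"
      using W(2) by blast
  qed blast
  moreover have "topspace (subtopology X U) = U"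
    using openin_subset[OF \<open>openin X U\<close>] by (rule topspace_subtopology_subset)
  ultimately have "resolvable_space (subtopology X U)"
    unfolding resolvable_space_def by (intro exI[of _ "A \<inter> U"] exI[of _ "U - A"]) auto
  then show False
    using assms(1) \<open>openin X U\<close> \<open>U \<noteq> {}\<close> unfolding strongly_irresolvable_space_def by blast
qed

lemma closure_of_subset_preclosure_of:
  assumes "strongly_irresolvable_space X" "preopenin X A"
  shows "X closure_of A \<subseteq> X preclosure_of A"
proof -
  have "X closure_of A \<subseteq> X closure_of (X interior_of A)"
    using preopen_subset_closure_of_interior[OF assms] by (simp add: closure_of_minimal)
  then show ?thesis
    using closure_of_interior_subset_preclosure_of by (rule subset_trans)
qed

lemma p_closed_imp_quasi_H_closed:
  assumes "p_closed_space X"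
  shows "quasi_H_closed_space X"
  unfolding quasi_H_closed_space_def
proof (intro allI impI, elim conjE)
  fix \<V> assume op: "\<forall>V\<in>\<V>. openin X V" and cover: "\<Union>\<V> = topspace X"
  have "\<forall>V\<in>\<V>. preopenin X V"
    using op open_imp_preopen by blast
  then obtain \<F> where \<F>: "finite \<F>" "\<F> \<subseteq> \<V>" "topspace X = (\<Union>V\<in>\<F>. X preclosure_of V)"
    using assms cover unfolding p_closed_space_def by metis
  have "X preclosure_of V \<subseteq> X closure_of V" if "V \<in> \<F>" for V
    using that \<F>(2) cover by (intro preclosure_of_subset_closure_of) blast
  then have "topspace X \<subseteq> (\<Union>V\<in>\<F>. X closure_of V)"
    unfolding \<F>(3) by (rule UN_mono[OF order_refl])
  then have "topspace X = (\<Union>V\<in>\<F>. X closure_of V)"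
    by (intro subset_antisym UN_least closure_of_subset_topspace)
  with \<F> show "\<exists>\<F>. finite \<F> \<and> \<F> \<subseteq> \<V> \<and> topspace X = (\<Union>V\<in>\<F>. X closure_of V)"
    by blast
qed

lemma quasi_H_closed_imp_p_closed:
  assumes irr: "strongly_irresolvable_space X" and qhc: "quasi_H_closed_space X"
  shows "p_closed_space X"
  unfolding p_closed_space_def
proof (intro allI impI, elim conjE)
  fix \<V> assume pre: "\<forall>V\<in>\<V>. preopenin X V" and cover: "\<Union>\<V> = topspace X"
  let ?I = "\<lambda>V. X interior_of (X closure_of V)"
  have "V \<subseteq> ?I V" if "V \<in> \<V>" for V
    using pre that unfolding preopenin_def by blast
  then have "topspace X \<subseteq> \<Union>(?I ` \<V>)"
    using cover by blast
  then have "\<Union>(?I ` \<V>) = topspace X"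
    by (intro subset_antisym UN_least interior_of_subset_topspace)
  moreover have "\<forall>W \<in> ?I ` \<V>. openin X W"
    by simp
  ultimately obtain \<G> where fin: "finite \<G>" and sub: "\<G> \<subseteq> ?I ` \<V>"
    and \<G>: "topspace X = (\<Union>W\<in>\<G>. X closure_of W)"
    using qhc unfolding quasi_H_closed_space_def by metis
  obtain \<F> where \<F>: "finite \<F>" "\<F> \<subseteq> \<V>" "\<G> = ?I ` \<F>"
    using finite_subset_image[OF fin sub] by blast
  have "X closure_of (?I V) \<subseteq> X preclosure_of V" if "V \<in> \<F>" for V
  proof -
    have "X closure_of (?I V) \<subseteq> X closure_of V"
      by (intro closure_of_minimal interior_of_subset closedin_closure_of)
    also have "\<dots> \<subseteq> X preclosure_of V"
      using pre that \<F>(2) by (intro closure_of_subset_preclosure_of[OF irr]) blast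
    finally show ?thesis .
  qed
  then have "topspace X \<subseteq> (\<Union>V\<in>\<F>. X preclosure_of V)"
    unfolding \<G> \<F>(3) by blast
  moreover have "X preclosure_of V \<subseteq> topspace X" if "V \<in> \<F>" for V
    using that \<F>(2) cover by (intro preclosure_of_subset_topspace) blast
  ultimately have "topspace X = (\<Union>V\<in>\<F>. X preclosure_of V)"
    by blast
  with \<F> show "\<exists>\<F>. finite \<F> \<and> \<F> \<subseteq> \<V> \<and> topspace X = (\<Union>V\<in>\<F>. X preclosure_of V)"
    by blast
qed

theorem corollary2p2:
  fixes X :: "'a topology"
  assumes "strongly_irresolvable_space X \<or> submaximal_space X"
  shows "p_closed_space X \<longleftrightarrow> quasi_H_closed_space X"
  using assms submaximal_imp_strongly_irresolvable p_closed_imp_quasi_H_closed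
    quasi_H_closed_imp_p_closed by blast

end
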